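(* Let $(X,\epsilon,\eta,\delta,\mu)$ be a Frobenius object in $\mathbf{Rel}$ and let $\mathcal X$ be its associated $2$-coskeletal simplicial set. Then: (1) The $2$-boundary map $\delta_2:\zeta\mapsto(d_2^2\zeta,d_0^2\zeta,d_1^2\zeta)$ on $X_2$ is injective. (2) For any $\zeta\in X_2$, if $d_0^2\zeta=s_0^0u$ for some $u\in X_0$, then $d_2^2\zeta=d_1^2\zeta$. Similarly, if $d_2^2\zeta=s_0^0u$ for some $u\in X_0$, then $d_0^2\zeta=d_1^2\zeta$.
   Context: In the category $\mathbf{Rel}$, objects are sets, a morphism $S:X\dashrightarrow Y$ is a subset $S\subseteq X\times Y$, composition is $T\circ S=\{(x,z)\mid \exists y:\ (x,y)\in S,\ (y,z)\in T\}$, the identity $\mathbf{1}$ is the diagonal, and $S\times T$ denotes the product relation (with $\{\bullet\}\times X\cong X\cong X\times\{\bullet\}$ identified). A Frobenius object in $\mathbf{Rel}$ is a set $X$ with morphisms $\epsilon:X\dashrightarrow\{\bullet\}$, $\eta:\{\bullet\}\dashrightarrow X$, $\delta:X\dashrightarrow X\times X$, $\mu:X\times X\dashrightarrow X$ such that (U) $\mu\circ(\eta\times\mathbf 1)=\mathbf 1=\mu\circ(\mathbf 1\times\eta)$; (C) $(\epsilon\times\mathbf 1)\circ\delta=\mathbf 1=(\mathbf 1\times\epsilon)\circ\delta$; (F) $(\mathbf 1\times\mu)\circ(\delta\times\mathbf 1)=\delta\circ\mu=(\mu\times\mathbf 1)\circ(\mathbf 1\times\delta)$. We view $\epsilon,\eta\subseteq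 X$ and $\delta,\mu\subseteq X^3$; $(x,y,z)\in\mu$ has inputs $x,y$ and output $z$; $(x,y,z)\in\delta$ has input $x$ and outputs $y,z$. Source and target maps $s,t:X\to\eta$: $s(x)$ is the unique element of $\eta$ with $(x,s(x),x)\in\mu$, and $t(x)$ the unique element of $\eta$ with $(t(x),x,x)\in\mu$. Associated simplicial set: $X_0=\eta$, $X_1=X$, $X_2=\mu$; $s_0^0$ is the inclusion $\eta\subseteq X$; $d_0^1=s$, $d_1^1=t$; $s_0^1(x)=(t(x),x,x)$, $s_1^1(x)=(x,s(x),x)$; $d_0^2(x,y,z)=y$, $d_1^2(x,y,z)=z$, $d_2^2(x,y,z)=x$. This is a $2$-truncated simplicial set, and $\mathcal X$ is its unique $2$-coskeletal extension (i.e. for $q>2$, $X_q$ is the set of tuples $(\zeta_0,\dots,\zeta_q)$ in $X_{q-1}$ with $d_i^{q-1}\zeta_j=d_{j-1}^{q-1}\zeta_i$ for $i<j$, with $d_i^q$ the $i$-th component). *)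

theory Defs
  imports Main
begin

section \<open>Frobenius objects in the category of sets and relations\<close>

text \<open>A morphism from \<open>A\<close> to \<open>B\<close> is a subset of \<open>A \<times> B\<close>, the identity of \<open>A\<close> is
  \<^term>\<open>Id_on A\<close>, and the composite ``\<open>T\<close> after \<open>S\<close>'' is \<^term>\<open>S O T\<close> (diagrammatic order).
  The one-point set is \<^term>\<open>UNIV :: unit set\<close>.\<close>

definition rel_times :: "('a \<times> 'b) set \<Rightarrow> ('c \<times> 'd) set \<Rightarrow> (('a \<times> 'c) \<times> ('b \<times> 'd)) set"
    (infixr "\<otimes>" 78) where
  "S \<otimes> T = {((a, c), (b, d)) | a b c d. (a, b) \<in> S \<and> (c, d) \<in> T}"

text \<open>The canonical bijections along which products of sets are identified.\<close>

definition left_unitor :: "'a set \<Rightarrow> ((unit \<times> 'a) \<times> 'a) set" where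
  "left_unitor A = {(((), x), x) | x. x \<in> A}"

definition right_unitor :: "'a set \<Rightarrow> (('a \<times> unit) \<times> 'a) set" where
  "right_unitor A = {((x, ()), x) | x. x \<in> A}"

definition associator :: "'a set \<Rightarrow> ((('a \<times> 'a) \<times> 'a) \<times> ('a \<times> ('a \<times> 'a))) set" where
  "associator A = {(((x, y), z), (x, (y, z))) | x y z. x \<in> A \<and> y \<in> A \<and> z \<in> A}"

locale frobenius_object =
  fixes X :: "'a set"
    and \<epsilon> :: "('a \<times> unit) set"
    and \<eta> :: "(unit \<times> 'a) set"
    and \<delta> :: "('a \<times> ('a \<times> 'a)) set"
    and \<mu> :: "(('a \<times> 'a) \<times> 'a) set"
  assumes counit_rel: "\<epsilon> \<subseteq> X \<times> UNIV"
    and unit_rel: "\<eta> \<subseteq> UNIV \<times> X"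
    and comult_rel: "\<delta> \<subseteq> X \<times> (X \<times> X)"
    and mult_rel: "\<mu> \<subseteq> (X \<times> X) \<times> X"
    and unit_left: "(\<eta> \<otimes> Id_on X) O \<mu> = left_unitor X"
    and unit_right: "(Id_on X \<otimes> \<eta>) O \<mu> = right_unitor X"
    and counit_left: "\<delta> O (\<epsilon> \<otimes> Id_on X) = (left_unitor X)\<inverse>"
    and counit_right: "\<delta> O (Id_on X \<otimes> \<epsilon>) = (right_unitor X)\<inverse>"
    and frobenius_left: "(\<delta> \<otimes> Id_on X) O associator X O (Id_on X \<otimes> \<mu>) = \<mu> O \<delta>"
    and frobenius_right: "(Id_on X \<otimes> \<delta>) O (associator X)\<inverse> O (\<mu> \<otimes> Id_on X) = \<mu> O \<delta>"

text \<open>The unit viewed as a subset of the carrier.\<close>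

definition units :: "(unit \<times> 'a) set \<Rightarrow> 'a set" where
  "units \<eta> = {u. ((), u) \<in> \<eta>}"

definition source :: "(unit \<times> 'a) set \<Rightarrow> (('a \<times> 'a) \<times> 'a) set \<Rightarrow> 'a \<Rightarrow> 'a" where
  "source \<eta> \<mu> x = (THE u. u \<in> units \<eta> \<and> ((x, u), x) \<in> \<mu>)"

definition target :: "(unit \<times> 'a) set \<Rightarrow> (('a \<times> 'a) \<times> 'a) set \<Rightarrow> 'a \<Rightarrow> 'a" where
  "target \<eta> \<mu> x = (THE u. u \<in> units \<eta> \<and> ((u, x), x) \<in> \<mu>)"


section \<open>The associated 2-coskeletal simplicial set\<close>

text \<open>A single type holding the simplices of all dimensions: dimensions 0, 1, 2 are tagged
  elements and triples of elements; a simplex of dimension \<open>q > 2\<close> is the list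
  \<open>[\<zeta>\<^sub>0, \<dots>, \<zeta>\<^sub>q]\<close> of its faces.\<close>

datatype 'a simplex = Vertex 'a | Edge 'a | Triangle 'a 'a 'a | Faces "'a simplex list"

text \<open>\<open>face \<eta> \<mu> q i\<close> is the \<open>i\<close>-th face map out of dimension \<open>q\<close>, meaningful for \<open>q \<ge> 1\<close>,
  \<open>i \<le> q\<close> and arguments of dimension \<open>q\<close>.\<close>

fun face :: "(unit \<times> 'a) set \<Rightarrow> (('a \<times> 'a) \<times> 'a) set \<Rightarrow> nat \<Rightarrow> nat \<Rightarrow> 'a simplex \<Rightarrow> 'a simplex"
  where
  "face \<eta> \<mu> (Suc 0) i (Edge x) = Vertex (if i = 0 then source \<eta> \<mu> x else target \<eta> \<mu> x)"
| "face \<eta> \<mu> (Suc (Suc 0)) i (Triangle x y z) = Edge (if i = 0 then y else if i = 1 then z else x)"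
| "face \<eta> \<mu> (Suc (Suc (Suc q))) i (Faces \<zeta>s) = \<zeta>s ! i"

fun simplices ::
  "'a set \<Rightarrow> (unit \<times> 'a) set \<Rightarrow> (('a \<times> 'a) \<times> 'a) set \<Rightarrow> nat \<Rightarrow> 'a simplex set" where
  "simplices X \<eta> \<mu> 0 = Vertex ` units \<eta>"
| "simplices X \<eta> \<mu> (Suc 0) = Edge ` X"
| "simplices X \<eta> \<mu> (Suc (Suc 0)) = {Triangle x y z | x y z. ((x, y), z) \<in> \<mu>}"
| "simplices X \<eta> \<mu> (Suc (Suc (Suc q))) =
     {Faces \<zeta>s | \<zeta>s. length \<zeta>s = q + 4 \<and> set \<zeta>s \<subseteq> simplices X \<eta> \<mu> (q + 2) \<and>
        (\<forall>i j. i < j \<and> j < q + 4 \<longrightarrow>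
           face \<eta> \<mu> (q + 2) i (\<zeta>s ! j) = face \<eta> \<mu> (q + 2) (j - 1) (\<zeta>s ! i))}"

text \<open>\<open>degeneracy \<eta> \<mu> q j\<close> is the \<open>j\<close>-th degeneracy map out of dimension \<open>q\<close>. A simplex of
  dimension at least 3 is its list of faces, so from dimension 2 on the simplicial identities
  \<open>d\<^sub>i s\<^sub>j = s\<^sub>j\<^sub>-\<^sub>1 d\<^sub>i\<close> for \<open>i < j\<close>, \<open>d\<^sub>j s\<^sub>j = d\<^sub>j\<^sub>+\<^sub>1 s\<^sub>j = id\<close> and
  \<open>d\<^sub>i s\<^sub>j = s\<^sub>j d\<^sub>i\<^sub>-\<^sub>1\<close> for \<open>i > j + 1\<close> leave no choice.\<close>

fun degeneracy ::
  "(unit \<times> 'a) set \<Rightarrow> (('a \<times> 'a) \<times> 'a) set \<Rightarrow> nat \<Rightarrow> nat \<Rightarrow> 'a simplex \<Rightarrow> 'a simplex" where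
  "degeneracy \<eta> \<mu> 0 j (Vertex u) = Edge u"
| "degeneracy \<eta> \<mu> (Suc 0) j (Edge x) =
     (if j = 0 then Triangle (target \<eta> \<mu> x) x x else Triangle x (source \<eta> \<mu> x) x)"
| "degeneracy \<eta> \<mu> (Suc (Suc q)) j \<zeta> =
     Faces (map (\<lambda>i. if i < j then degeneracy \<eta> \<mu> (Suc q) (j - 1) (face \<eta> \<mu> (q + 2) i \<zeta>)
                     else if i \<le> j + 1 then \<zeta>
                     else degeneracy \<eta> \<mu> (Suc q) j (face \<eta> \<mu> (q + 2) (i - 1) \<zeta>))
                [0..<q + 4])"

definition boundary2 ::
  "(unit \<times> 'a) set \<Rightarrow> (('a \<times> 'a) \<times> 'a) set \<Rightarrow> 'a simplex \<Rightarrow>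
     'a simplex \<times> 'a simplex \<times> 'a simplex" where
  "boundary2 \<eta> \<mu> \<zeta> = (face \<eta> \<mu> 2 2 \<zeta>, face \<eta> \<mu> 2 0 \<zeta>, face \<eta> \<mu> 2 1 \<zeta>)"

end

theory Submission
  imports Defs
begin

text \<open>A 2-simplex is a triple \<open>(x, y, z)\<close> in \<open>\<mu>\<close> with faces
  \<open>y\<close>, \<open>z\<close>, \<open>x\<close>, so its boundary lists all its entries and
  determines it. For the second part, a degenerate face \<open>y\<close> or \<open>x\<close> is an
  element of \<open>\<eta>\<close>; axiom (U) says that multiplying by such an element relates
  nothing but equal elements, which forces \<open>x = z\<close> or \<open>y = z\<close>
  (\<open>mult_unit_right_eq\<close>, \<open>mult_unit_left_eq\<close>).\<close>

context frobenius_object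
begin

lemma mult_unit_right_eq:
  assumes "((x, u), z) \<in> \<mu>" and "u \<in> units \<eta>"
  shows "x = z"
proof -
  \<comment> \<open>Followed by the given triple, this is a path through \<open>u\<close> in the
    composite that (U) identifies with \<open>right_unitor X\<close>.\<close>
  have "((x, ()), (x, u)) \<in> Id_on X \<otimes> \<eta>"
    using assms mult_rel by (auto simp: rel_times_def units_def)
  with assms(1) have "((x, ()), z) \<in> right_unitor X"
    unfolding unit_right[symmetric] by blast
  then show ?thesis by (simp add: right_unitor_def)
qed

lemma mult_unit_left_eq:
  assumes "((u, y), z) \<in> \<mu>" and "u \<in> units \<eta>"
  shows "y = z"
proof -
  have "(((), y), (u, y)) \<in> \<eta> \<otimes> Id_on X"
    using assms mult_rel by (auto simp: rel_times_def units_def)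
  with assms(1) have "(((), y), z) \<in> left_unitor X"
    unfolding unit_left[symmetric] by blast
  then show ?thesis by (simp add: left_unitor_def)
qed

end

theorem proposition5p2:
  fixes X :: "'a set"
    and \<epsilon> :: "('a \<times> unit) set"
    and \<eta> :: "(unit \<times> 'a) set"
    and \<delta> :: "('a \<times> ('a \<times> 'a)) set"
    and \<mu> :: "(('a \<times> 'a) \<times> 'a) set"
  assumes "frobenius_object X \<epsilon> \<eta> \<delta> \<mu>"
  shows "inj_on (boundary2 \<eta> \<mu>) (simplices X \<eta> \<mu> 2)
    \<and> (\<forall>\<zeta> \<in> simplices X \<eta> \<mu> 2.
          ((\<exists>u \<in> simplices X \<eta> \<mu> 0. face \<eta> \<mu> 2 0 \<zeta> = degeneracy \<eta> \<mu> 0 0 u)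
             \<longrightarrow> face \<eta> \<mu> 2 2 \<zeta> = face \<eta> \<mu> 2 1 \<zeta>)
        \<and> ((\<exists>u \<in> simplices X \<eta> \<mu> 0. face \<eta> \<mu> 2 2 \<zeta> = degeneracy \<eta> \<mu> 0 0 u)
             \<longrightarrow> face \<eta> \<mu> 2 0 \<zeta> = face \<eta> \<mu> 2 1 \<zeta>))"
proof -
  interpret frobenius_object X \<epsilon> \<eta> \<delta> \<mu> by (fact assms)
  show ?thesis
    \<comment> \<open>The equations of \<open>face\<close> and \<open>simplices\<close> match on
      \<open>Suc (Suc 0)\<close>, hence the rewriting of the numeral.\<close>
    by (auto simp: inj_on_def boundary2_def numeral_2_eq_2
        dest: mult_unit_right_eq mult_unit_left_eq)
qed

end
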